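(* Let $p$ be a nonnegative integer and $\lambda$ a real number with $\lambda\ne 1$. Then $$\sum_{\substack{\alpha_1+\alpha_2=p+3\\ \alpha_1,\alpha_2\ge1}}\Bigl[(\lambda^{\alpha_1-1}+1)(\lambda+1)^{\alpha_2}-\lambda^{\alpha_1-1}-\lambda^{\alpha_2}\Bigr]\zeta(\alpha_1,\alpha_2+1)=\frac{\lambda^{p+3}-1}{\lambda-1}\,\zeta(p+4).$$
   Context: $\zeta(\alpha_1,\alpha_2)=\sum_{1\le k_1<k_2}k_1^{-\alpha_1}k_2^{-\alpha_2}$ for positive integers $\alpha_1$, $\alpha_2\ge 2$, and $\zeta$ is the Riemann zeta function. The convention $\lambda^0=1$ (also for $\lambda=0$) is used. *)

theory Defs
  imports "HOL-Analysis.Analysis"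
begin

(* The Riemann zeta function at integers s \<ge> 2, where its defining series converges. *)
definition zeta :: "nat \<Rightarrow> real" where
  "zeta s = (\<Sum>\<^sub>\<infinity>k\<in>{1::nat..}. 1 / real k ^ s)"

(* The larger summation index carries the second argument; all terms are nonnegative, and
   the series converges for a \<ge> 1 and b \<ge> 2. *)
definition double_zeta :: "nat \<Rightarrow> nat \<Rightarrow> real" where
  "double_zeta a b =
     (\<Sum>\<^sub>\<infinity>(k1, k2)\<in>{(k1::nat, k2::nat). 1 \<le> k1 \<and> k1 < k2}. 1 / (real k1 ^ a * real k2 ^ b))"

end

theory Submission
  imports Defs "HOL-Real_Asymp.Real_Asymp"
begin

text \<open>
  Put \<open>N = p + 2\<close>. For \<open>x, y \<ge> 1\<close> the geometric sum
  \<open>\<Sum>j\<le>N. \<lambda>^j / (x^(j+1) y^(N-j+1))\<close> splits by partial fractions into terms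
  \<open>1 / (y^a (x+y)^b)\<close> and \<open>1 / (x^a (x+y)^b)\<close>. Moving the two non-summable terms with
  \<open>b = 1\<close> to the left and summing over all \<open>x, y\<close>, the right-hand side gives double zeta
  values because \<open>(x, y) \<mapsto> (x, x + y)\<close> parametrises the pairs \<open>k1 < k2\<close>. On the
  left, the terms with \<open>0 < j < N\<close> are split according to \<open>x < y\<close>, \<open>x > y\<close>, \<open>x = y\<close>, and
  the two boundary terms telescope to \<open>\<Sum>y. H_y / y^(N+1) = \<zeta>(1, N+1) + \<zeta>(N+2)\<close>.
\<close>

section \<open>Partial fractions for the geometric sum\<close>

lemma geometric_partial_fractions:
  fixes x y l :: real
  assumes "x > 0" "y > 0"
  shows "(\<Sum>i\<le>N. l ^ i * (1 / (x ^ (i + 1) * y ^ (N - i + 1)))) =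
         (\<Sum>i\<le>N. (l + 1) ^ (N - i) * (1 / (y ^ (i + 1) * (x + y) ^ (N - i + 1)) +
                   l ^ i * (1 / (x ^ (i + 1) * (x + y) ^ (N - i + 1)))))"
proof -
  \<comment> \<open>Up to outer factors the three sums are \<open>h A B\<close>,
    \<open>h B C\<close> and \<open>h A C\<close>. The differences \<open>A - B\<close>,
    \<open>C - B\<close> and \<open>A - C\<close> all have numerator \<open>l * y - x\<close>, over
    exactly the denominators of those outer factors. Multiplying by this numerator therefore leaves
    differences of powers with exponent \<open>N + 1\<close>, which telescope through
    \<open>C\<close>.\<close>
  define A B C where "A = l / x" and "B = 1 / y" and "C = (l + 1) / (x + y)"
  define h where "h u v = (\<Sum>i\<le>N. u ^ i * v ^ (N - i))" for u v :: real
  have h: "(u - v) * h u v = u ^ Suc N - v ^ Suc N" for u v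
    unfolding h_def lessThan_Suc_atMost[symmetric] power_diff_sumr2[of u "Suc N" v]
    by (simp add: mult.commute)
  have h_sym: "h u v = h v u" for u v
    unfolding h_def by (rule sum.reindex_bij_witness[of _ "\<lambda>i. N - i" "\<lambda>i. N - i"])
      (auto simp: mult.commute)
  have xy: "x + y \<noteq> 0" using assms by simp
  have lhs: "(\<Sum>i\<le>N. l ^ i * (1 / (x ^ (i + 1) * y ^ (N - i + 1)))) = h A B / (x * y)"
    unfolding h_def sum_divide_distrib
    by (intro sum.cong refl) (simp add: A_def B_def power_divide)
  have rhs: "(\<Sum>i\<le>N. (l + 1) ^ (N - i) * (1 / (y ^ (i + 1) * (x + y) ^ (N - i + 1)) +
               l ^ i * (1 / (x ^ (i + 1) * (x + y) ^ (N - i + 1)))))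
             = h B C / (y * (x + y)) + h A C / (x * (x + y))"
    unfolding h_def sum_divide_distrib sum.distrib[symmetric]
    by (intro sum.cong refl)
      (simp add: A_def B_def C_def power_divide mult_ac distrib_left[of _ "1 / _"])
  have "h A B / (x * y) = h B C / (y * (x + y)) + h A C / (x * (x + y))"
  proof (cases "l * y = x")
    \<comment> \<open>The multiplier vanishes here, but then \<open>A\<close>, \<open>B\<close> and
      \<open>C\<close> coincide, and only the partial fraction of \<open>1 / (x * y)\<close>
      remains.\<close>
    case True
    have "A = B" "C = B"
      using assms xy True by (auto simp: A_def B_def C_def field_simps)
    moreover have "1 / (x * y) = 1 / (y * (x + y)) + 1 / (x * (x + y))"
      using assms xy by (simp add: divide_simps)
    then have "h B B * (1 / (x * y)) = h B B * (1 / (y * (x + y)) + 1 / (x * (x + y)))"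
      by (rule arg_cong)
    ultimately show ?thesis
      by (simp only: distrib_left times_divide_eq_right mult_1_right)
  next
    case False
    define t where "t = l * y - x"
    have t: "t \<noteq> 0" using False by (simp add: t_def)
    have 1: "t / (x * y) = A - B" "t / (y * (x + y)) = C - B" "t / (x * (x + y)) = A - C"
      using assms xy by (auto simp: A_def B_def C_def t_def divide_simps) (auto simp: algebra_simps)
    have "t * (h A B / (x * y)) = (A - B) * h A B"
      by (simp flip: 1)
    also have "\<dots> = (C - B) * h C B + (A - C) * h A C"
      by (simp add: h)
    also have "\<dots> = t * (h B C / (y * (x + y)) + h A C / (x * (x + y)))"
      by (simp add: distrib_left h_sym[of B C] flip: 1)
    finally show ?thesis using t by (simp only: mult_cancel_left simp_thms)
  qed
  with lhs rhs show ?thesis by simp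
qed

section \<open>Convergence of the double series and sums over the quadrant\<close>

lemma summable_on_inverse_power:
  assumes "s \<ge> 2"
  shows "(\<lambda>k. 1 / real k ^ s) summable_on {1..}"
proof -
  have "summable (\<lambda>k. inverse (real k ^ s))"
    by (rule inverse_power_summable[OF assms])
  then have "(\<lambda>k. 1 / real k ^ s) summable_on UNIV"
    by (intro summable_nonneg_imp_summable_on) (simp_all add: inverse_eq_divide)
  then show ?thesis
    by (rule summable_on_subset_banach) simp
qed

lemma has_sum_zeta:
  assumes "s \<ge> 2"
  shows "((\<lambda>k. 1 / real k ^ s) has_sum zeta s) {1..}"
  unfolding zeta_def by (rule has_sum_infsum[OF summable_on_inverse_power[OF assms]])

text \<open>Serves as the common majorant in the convergence proofs for double series below.\<close>

lemma summable_on_inverse_squares: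
  "(\<lambda>(x, y). 1 / (real x ^ 2 * real y ^ 2)) summable_on {1..} \<times> {1..}"
proof (rule summable_on_SigmaI)
  show "((\<lambda>y. case (x, y) of (x, y) \<Rightarrow> 1 / (real x ^ 2 * real y ^ 2)) has_sum
          1 / real x ^ 2 * zeta 2) {1..}" for x
    using has_sum_cmult_right[OF has_sum_zeta[of 2], of "1 / real x ^ 2"] by simp
  show "(\<lambda>x. 1 / real x ^ 2 * zeta 2) summable_on {1..}"
    using has_sum_cmult_left[OF has_sum_zeta[of 2], of "zeta 2"]
    by (simp add: has_sum_imp_summable)
qed auto

lemma summable_on_inverse_squares_bound:
  fixes f :: "nat \<times> nat \<Rightarrow> real"
  assumes "\<And>x y. x \<ge> 1 \<Longrightarrow> y \<ge> 1 \<Longrightarrow> 0 \<le> f (x, y)"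
    and "\<And>x y. x \<ge> 1 \<Longrightarrow> y \<ge> 1 \<Longrightarrow> f (x, y) \<le> 1 / (real x ^ 2 * real y ^ 2)"
  shows "f summable_on {1..} \<times> {1..}"
  by (rule summable_on_comparison_test[OF summable_on_inverse_squares]) (use assms in auto)

text \<open>Stated for an arbitrary value \<open>s\<close>, so that it transports summability as
  well as the value of the sum.\<close>

lemma has_sum_shift_iff:
  "((\<lambda>(x, y). 1 / (real x ^ a * (real x + real y) ^ b)) has_sum s) ({1..} \<times> {1..}) \<longleftrightarrow>
   ((\<lambda>(k1, k2). 1 / (real k1 ^ a * real k2 ^ b)) has_sum s) {(k1, k2). 1 \<le> k1 \<and> k1 < k2}"
  by (rule has_sum_reindex_bij_witness[where i = "\<lambda>(k1, k2). (k1, k2 - k1)"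
        and j = "\<lambda>(x, y). (x, x + y)"]) auto

text \<open>The condition \<open>a + b \<ge> 4\<close> makes the majorant by inverse squares
  available: it excludes \<open>a = 1\<close>, \<open>b = 2\<close>, where
  \<open>x * (x + y)^2\<close> can be smaller than \<open>x^2 * y^2\<close>.\<close>

lemma has_sum_double_zeta_shift:
  assumes "a \<ge> 1" "b \<ge> 2" "a + b \<ge> 4"
  shows "((\<lambda>(x, y). 1 / (real x ^ a * (real x + real y) ^ b)) has_sum double_zeta a b)
           ({1..} \<times> {1..})"
proof -
  let ?f = "\<lambda>(x, y). 1 / (real x ^ a * (real x + real y) ^ b)"
  let ?g = "\<lambda>(k1, k2). 1 / (real k1 ^ a * real k2 ^ b)"
  let ?D = "{(k1::nat, k2::nat). 1 \<le> k1 \<and> k1 < k2}"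
  have "?f summable_on {1..} \<times> {1..}"
  proof (rule summable_on_inverse_squares_bound)
    fix x y :: nat
    assume xy: "x \<ge> 1" "y \<ge> 1"
    have "real x ^ 2 * real y ^ 2 \<le> real x ^ a * (real x + real y) ^ b"
    proof (cases "a = 1")
      \<comment> \<open>Now \<open>b \<ge> 3\<close>, and the spare factor
        \<open>x + y \<ge> x\<close> supplies the missing power of \<open>x\<close>.\<close>
      case True
      have "real x ^ 2 * real y ^ 2 = real x * (real x * real y ^ 2)"
        by (simp add: power2_eq_square)
      also have "\<dots> \<le> real x * ((real x + real y) * (real x + real y) ^ 2)"
        by (intro mult_left_mono mult_mono power_mono) auto
      also have "(real x + real y) * (real x + real y) ^ 2 = (real x + real y) ^ 3"
        by (simp add: power2_eq_square power3_eq_cube)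
      also have "\<dots> \<le> (real x + real y) ^ b"
        using xy assms True by (intro power_increasing) auto
      finally show ?thesis using True xy by (simp add: mult_left_mono)
    next
      case False
      have "real y ^ 2 \<le> (real x + real y) ^ 2" by (intro power_mono) auto
      also have "\<dots> \<le> (real x + real y) ^ b"
        using xy assms by (intro power_increasing) auto
      finally show ?thesis
        using xy assms False by (intro mult_mono power_increasing) auto
    qed
    then show "?f (x, y) \<le> 1 / (real x ^ 2 * real y ^ 2)"
      using xy by (simp add: frac_le)
  qed auto
  \<comment> \<open>Since \<open>double_zeta\<close> is an \<open>infsum\<close>, summability over
    its own index set is all that is needed to identify the value.\<close>
  then have "?g summable_on ?D"
    unfolding summable_on_def has_sum_shift_iff .
  then show ?thesis
    unfolding has_sum_shift_iff double_zeta_def by (rule has_sum_infsum)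
qed

lemma has_sum_double_zeta:
  assumes "a \<ge> 1" "b \<ge> 2" "a + b \<ge> 4"
  shows "((\<lambda>(k1, k2). 1 / (real k1 ^ a * real k2 ^ b)) has_sum double_zeta a b)
           {(k1, k2). 1 \<le> k1 \<and> k1 < k2}"
  using has_sum_double_zeta_shift[OF assms] unfolding has_sum_shift_iff .

lemma has_sum_double_zeta_diagonal:
  assumes "a \<ge> 1" "b \<ge> 2" "a + b \<ge> 4"
  shows "((\<lambda>(k1, k2). 1 / (real k1 ^ a * real k2 ^ b)) has_sum double_zeta a b + zeta (a + b))
           {(k1, k2). 1 \<le> k1 \<and> k1 \<le> k2}"
proof -
  let ?f = "\<lambda>(k1, k2). 1 / (real k1 ^ a * real k2 ^ b)"
  let ?D = "{(k1::nat, k2::nat). 1 \<le> k1 \<and> k1 < k2}" and ?E = "{(k1::nat, k2::nat). 1 \<le> k1 \<and> k1 = k2}"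
  have "(?f has_sum zeta (a + b)) ?E = ((\<lambda>k. 1 / real k ^ (a + b)) has_sum zeta (a + b)) {1..}"
    by (rule has_sum_reindex_bij_witness[where i = "\<lambda>k. (k, k)" and j = fst])
      (auto simp: power_add)
  then have "(?f has_sum zeta (a + b)) ?E"
    using has_sum_zeta assms by simp
  then have "(?f has_sum double_zeta a b + zeta (a + b)) (?D \<union> ?E)"
    by (intro has_sum_Un_disjoint has_sum_double_zeta assms) auto
  also have "?D \<union> ?E = {(k1, k2). 1 \<le> k1 \<and> k1 \<le> k2}" by auto
  finally show ?thesis .
qed

text \<open>Stuffle product: the region x \<le> y contains the diagonal and so contributes
  \<open>zeta (a + b)\<close> too, while swapping coordinates turns y < x into the index set of
  \<open>double_zeta b a\<close>.\<close>

lemma has_sum_stuffle: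
  assumes "a \<ge> 2" "b \<ge> 2"
  shows "((\<lambda>(x, y). 1 / (real x ^ a * real y ^ b)) has_sum
            double_zeta a b + double_zeta b a + zeta (a + b)) ({1..} \<times> {1..})"
proof -
  let ?f = "\<lambda>(x, y). 1 / (real x ^ a * real y ^ b)"
  let ?D = "{(x::nat, y::nat). 1 \<le> x \<and> x \<le> y}" and ?E = "{(x::nat, y::nat). 1 \<le> y \<and> y < x}"
  have "(?f has_sum double_zeta b a) ?E = ((\<lambda>(k1, k2). 1 / (real k1 ^ b * real k2 ^ a)) has_sum
          double_zeta b a) {(k1, k2). 1 \<le> k1 \<and> k1 < k2}"
    by (rule has_sum_reindex_bij_witness[where i = prod.swap and j = prod.swap])
      (auto simp: mult.commute)
  then have "(?f has_sum double_zeta b a) ?E"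
    using has_sum_double_zeta[of b a] assms by simp
  then have "(?f has_sum (double_zeta a b + zeta (a + b)) + double_zeta b a) (?D \<union> ?E)"
    using assms by (intro has_sum_Un_disjoint has_sum_double_zeta_diagonal) auto
  also have "?D \<union> ?E = {1..} \<times> {1..}" by auto
  finally show ?thesis by (simp add: algebra_simps)
qed

section \<open>Harmonic sums for the two boundary terms\<close>

lemma has_sum_harmonic_telescope:
  "((\<lambda>x. 1 / real x - 1 / (real x + real y)) has_sum (\<Sum>k=1..y. 1 / real k)) {1..}"
proof (induction y)
  case 0
  then show ?case by simp
next
  case (Suc y)
  \<comment> \<open>Passing from \<open>y\<close> to \<open>y + 1\<close> adds a series in
    \<open>x\<close> that telescopes to \<open>1 / (y + 1)\<close>. The index \<open>n\<close>
    stands for \<open>x - 1\<close>.\<close>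
  let ?f = "\<lambda>n. 1 / (real n + 1 + real y)"
  have "?f \<longlonglongrightarrow> 0"
    by real_asymp
  then have "(\<lambda>n. ?f n - ?f (Suc n)) sums (?f 0 - 0)"
    by (rule telescope_sums')
  then have "((\<lambda>n. ?f n - ?f (Suc n)) has_sum 1 / real (Suc y)) UNIV"
    by (intro sums_nonneg_imp_has_sum) (simp_all add: field_simps)
  also have "((\<lambda>n. ?f n - ?f (Suc n)) has_sum 1 / real (Suc y)) UNIV =
      ((\<lambda>x. 1 / (real x + real y) - 1 / (real x + real (Suc y))) has_sum 1 / real (Suc y)) {1..}"
    by (rule has_sum_reindex_bij_witness[where i = "\<lambda>x. x - 1" and j = Suc]) (auto simp: algebra_simps)
  finally show ?case
    using has_sum_add[OF Suc.IH] by fastforce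
qed

text \<open>Summing over \<open>x\<close> first produces the harmonic number of \<open>y\<close>;
  expanding it gives a sum over pairs k1 \<le> k2 = y, diagonal included. The difference must stay
  together, since neither of its two parts is summable over \<open>x\<close>.\<close>

lemma has_sum_harmonic_double_zeta:
  assumes "N \<ge> 2"
  shows "((\<lambda>(y, x). 1 / real y ^ (N + 1) * (1 / real x - 1 / (real x + real y))) has_sum
            double_zeta 1 (N + 1) + zeta (N + 2)) ({1..} \<times> {1..})"
proof (rule has_sum_SigmaI)
  let ?H = "\<lambda>y. 1 / real y ^ (N + 1) * (\<Sum>k=1..y. 1 / real k)"
  let ?f = "\<lambda>(k1, k2). 1 / (real k1 ^ 1 * real k2 ^ (N + 1))"
  let ?s = "double_zeta 1 (N + 1) + zeta (N + 2)"
  show "((\<lambda>x. case (y, x) of (y, x) \<Rightarrow>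
            1 / real y ^ (N + 1) * (1 / real x - 1 / (real x + real y))) has_sum ?H y) {1..}" for y
    unfolding prod.case by (rule has_sum_cmult_right[OF has_sum_harmonic_telescope])
  have "(?f has_sum ?s) {(k1, k2). 1 \<le> k1 \<and> k1 \<le> k2}"
    using has_sum_double_zeta_diagonal[of 1 "N + 1"] assms by simp
  \<comment> \<open>The larger index becomes the outer one, so that each inner sum is finite and
    equals \<open>?H\<close>.\<close>
  also have "(?f has_sum ?s) {(k1, k2). 1 \<le> k1 \<and> k1 \<le> k2} =
      ((\<lambda>(k2, k1). ?f (k1, k2)) has_sum ?s) (SIGMA k2:{1..}. {1..k2})"
    by (rule has_sum_reindex_bij_witness[where i = prod.swap and j = prod.swap]) auto
  finally show "(?H has_sum ?s) {1..}"
    by (rule has_sum_SigmaD) (auto simp: has_sum_finite_iff sum_distrib_left mult.commute)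
  show "(\<lambda>(y, x). 1 / real y ^ (N + 1) * (1 / real x - 1 / (real x + real y)))
          summable_on {1..} \<times> {1..}"
  proof (rule summable_on_inverse_squares_bound, unfold prod.case)
    fix y x :: nat
    assume xy: "y \<ge> 1" "x \<ge> 1"
    show "0 \<le> 1 / real y ^ (N + 1) * (1 / real x - 1 / (real x + real y))"
      using xy by (intro mult_nonneg_nonneg) (auto simp: field_simps)
    \<comment> \<open>The difference equals \<open>y / (x * (x + y))\<close>, which cancels one
      power of \<open>y\<close>; at least two powers remain because
      \<open>N \<ge> 2\<close>.\<close>
    have "1 / real y ^ (N + 1) * (1 / real x - 1 / (real x + real y)) =
        1 / (real y ^ N * (real x * (real x + real y)))"
      using xy by (simp add: divide_simps)
    also have "\<dots> \<le> 1 / (real y ^ 2 * real x ^ 2)"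
    proof (rule frac_le)
      show "real y ^ 2 * real x ^ 2 \<le> real y ^ N * (real x * (real x + real y))"
        using xy assms by (intro mult_mono power_increasing) (auto simp: power2_eq_square)
    qed (use xy in auto)
    finally show "1 / real y ^ (N + 1) * (1 / real x - 1 / (real x + real y))
        \<le> 1 / (real y ^ 2 * real x ^ 2)" .
  qed
qed

section \<open>Summing the identity over the quadrant, and the final cancellation\<close>

lemma has_sum_finite_sum:
  fixes f :: "'i \<Rightarrow> 'a \<Rightarrow> 'b :: topological_comm_monoid_add"
  assumes "\<And>i. i \<in> I \<Longrightarrow> (f i has_sum s i) A"
  shows "((\<lambda>x. \<Sum>i\<in>I. f i x) has_sum (\<Sum>i\<in>I. s i)) A"
  using assms by (induction I rule: infinite_finite_induct) (auto intro: has_sum_add)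

lemma double_zeta_weighted_sum:
  fixes l :: real
  assumes N: "N \<ge> 2"
  shows "(\<Sum>i<N. ((l ^ i + 1) * (l + 1) ^ (N - i)) * double_zeta (i + 1) (N - i + 1)) =
         (\<Sum>j=1..<N. l ^ j * (double_zeta (j + 1) (N - j + 1) + double_zeta (N - j + 1) (j + 1)
                               + zeta (N + 2)))
         + (1 + l ^ N) * (double_zeta 1 (N + 1) + zeta (N + 2))" (is "?L = ?R")
proof (rule has_sum_unique)
  let ?P = "{1::nat..} \<times> {1::nat..}"
  let ?s = "double_zeta 1 (N + 1) + zeta (N + 2)"
  \<comment> \<open>The partial fraction side without \<open>i = N\<close>, the only index at which
    \<open>x + y\<close> occurs to the first power.\<close>
  define F where "F = (\<lambda>(x::nat, y::nat). \<Sum>i<N. (l + 1) ^ (N - i) *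
      (1 / (real y ^ (i + 1) * (real x + real y) ^ (N - i + 1)) +
       l ^ i * (1 / (real x ^ (i + 1) * (real x + real y) ^ (N - i + 1)))))"
  \<comment> \<open>The omitted terms are subtracted from the boundary terms \<open>j = 0\<close>
    and \<open>j = N\<close>, turning these into the summable harmonic differences; the interior
    terms have both exponents at least 2 and fall under the stuffle product.\<close>
  define G where "G = (\<lambda>(x::nat, y::nat).
      (\<Sum>j=1..<N. l ^ j * (1 / (real x ^ (j + 1) * real y ^ (N - j + 1)))) +
      (1 / real y ^ (N + 1) * (1 / real x - 1 / (real x + real y)) +
       l ^ N * (1 / real x ^ (N + 1) * (1 / real y - 1 / (real y + real x)))))"
  have eq: "F z = G z" if zP: "z \<in> ?P" for z
  proof -
    obtain x y where z: "z = (x, y)" "x \<ge> 1" "y \<ge> 1" using zP by auto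
    let ?t = "\<lambda>i. l ^ i * (1 / (real x ^ (i + 1) * real y ^ (N - i + 1)))"
    have "{..N} = insert 0 (insert N {1..<N})" using N by auto
    then have "(\<Sum>i\<le>N. ?t i) = ?t 0 + ?t N + (\<Sum>i=1..<N. ?t i)"
      using N by simp
    moreover have "(\<Sum>i\<le>N. ?t i) = F z + (1 / (real y ^ (N + 1) * (real x + real y)) +
        l ^ N * (1 / (real x ^ (N + 1) * (real x + real y))))"
      using geometric_partial_fractions[of "real x" "real y" l N] z
      by (simp add: F_def flip: lessThan_Suc_atMost)
    ultimately have "F z = ?t 0 + ?t N + (\<Sum>i=1..<N. ?t i)
        - (1 / (real y ^ (N + 1) * (real x + real y)) + l ^ N * (1 / (real x ^ (N + 1) * (real x + real y))))"
      by linarith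
    then show ?thesis
      by (simp add: z G_def right_diff_distrib add.commute[of "real y"])
  qed
  have "(F has_sum (\<Sum>i<N. (l + 1) ^ (N - i) *
      (double_zeta (i + 1) (N - i + 1) + l ^ i * double_zeta (i + 1) (N - i + 1)))) ?P"
    unfolding F_def case_prod_unfold
  proof (intro has_sum_finite_sum has_sum_cmult_right has_sum_add)
    fix i assume i: "i \<in> {..<N}"
    then have *: "((\<lambda>(x, y). 1 / (real x ^ (i + 1) * (real x + real y) ^ (N - i + 1)))
        has_sum double_zeta (i + 1) (N - i + 1)) ?P"
      using N by (intro has_sum_double_zeta_shift) auto
    show "((\<lambda>z. 1 / (real (fst z) ^ (i + 1) * (real (fst z) + real (snd z)) ^ (N - i + 1)))
        has_sum double_zeta (i + 1) (N - i + 1)) ?P"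
      using * by (simp add: case_prod_unfold)
    show "((\<lambda>z. 1 / (real (snd z) ^ (i + 1) * (real (fst z) + real (snd z)) ^ (N - i + 1)))
        has_sum double_zeta (i + 1) (N - i + 1)) ?P"
      using iffD1[OF has_sum_swap *] by (simp add: case_prod_unfold add.commute)
  qed
  also have "(\<Sum>i<N. (l + 1) ^ (N - i) *
      (double_zeta (i + 1) (N - i + 1) + l ^ i * double_zeta (i + 1) (N - i + 1))) = ?L"
    by (intro sum.cong refl) (simp add: algebra_simps)
  finally show "(F has_sum ?L) ?P" .
  have H: "((\<lambda>(y, x). 1 / real y ^ (N + 1) * (1 / real x - 1 / (real x + real y))) has_sum ?s) ?P"
    by (rule has_sum_harmonic_double_zeta[OF N])
  have "(G has_sum (\<Sum>j=1..<N. l ^ j * (double_zeta (j + 1) (N - j + 1)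
      + double_zeta (N - j + 1) (j + 1) + zeta (N + 2))) + (?s + l ^ N * ?s)) ?P"
    unfolding G_def case_prod_unfold
  proof (intro has_sum_finite_sum has_sum_cmult_right has_sum_add)
    fix j assume j: "j \<in> {1..<N}"
    then show "((\<lambda>z. 1 / (real (fst z) ^ (j + 1) * real (snd z) ^ (N - j + 1))) has_sum
        double_zeta (j + 1) (N - j + 1) + double_zeta (N - j + 1) (j + 1) + zeta (N + 2)) ?P"
      using has_sum_stuffle[of "j + 1" "N - j + 1"] by (auto simp: case_prod_unfold)
  next
    show "((\<lambda>z. 1 / real (snd z) ^ (N + 1) * (1 / real (fst z) - 1 / (real (fst z) + real (snd z))))
        has_sum ?s) ?P"
      using iffD1[OF has_sum_swap H] by (simp add: case_prod_unfold)
    show "((\<lambda>z. 1 / real (fst z) ^ (N + 1) * (1 / real (snd z) - 1 / (real (snd z) + real (fst z))))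
        has_sum ?s) ?P"
      using H by (simp add: case_prod_unfold)
  qed
  then have "(G has_sum ?R) ?P"
    by (simp add: algebra_simps)
  then show "(F has_sum ?R) ?P"
    using has_sum_cong[of ?P F G] eq by blast
qed

theorem theorem1p3:
  fixes p :: nat and l :: real
  assumes "l \<noteq> 1"
  shows "(\<Sum>(\<alpha>1, \<alpha>2)\<in>{(\<alpha>1::nat, \<alpha>2::nat). \<alpha>1 + \<alpha>2 = p + 3 \<and> \<alpha>1 \<ge> 1 \<and> \<alpha>2 \<ge> 1}.
            ((l ^ (\<alpha>1 - 1) + 1) * (l + 1) ^ \<alpha>2 - l ^ (\<alpha>1 - 1) - l ^ \<alpha>2) * double_zeta \<alpha>1 (\<alpha>2 + 1))
         = (l ^ (p + 3) - 1) / (l - 1) * zeta (p + 4)"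
proof -
  define N where "N = p + 2"
  have N: "N \<ge> 2" and weight: "N + 2 = p + 4" by (simp_all add: N_def)
  let ?d = "\<lambda>i. double_zeta (i + 1) (N - i + 1)"
  \<comment> \<open>Index 0 is separated because its \<open>double_zeta 1 (N + 1)\<close> comes from
    the harmonic sums and not from the stuffle product.\<close>
  have split_0: "{..<N} = insert 0 {1..<N}" using N by auto
  have rev: "(\<Sum>i=1..<N. l ^ (N - i) * ?d i) = (\<Sum>j=1..<N. l ^ j * double_zeta (N - j + 1) (j + 1))"
    by (rule sum.reindex_bij_witness[of _ "\<lambda>i. N - i" "\<lambda>i. N - i"]) auto
  have geo: "(\<Sum>j=1..<N. l ^ j) + 1 + l ^ N = (l ^ (p + 3) - 1) / (l - 1)"
  proof -
    have "(\<Sum>j=1..<N. l ^ j) + 1 + l ^ N = (\<Sum>j<Suc N. l ^ j)"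
      using split_0 by simp
    also have "\<dots> = (l ^ Suc N - 1) / (l - 1)"
      by (rule geometric_sum[OF assms])
    finally show ?thesis by (simp add: N_def numeral_3_eq_3)
  qed
  have diff: "b = N + 1 - a" if "a + b = p + 3" for a b
    using that by (simp add: N_def)
  \<comment> \<open>Put \<open>i = \<alpha>1 - 1\<close>; as \<open>p + 3 = N + 1\<close>, this
    gives \<open>\<alpha>2 = N - i\<close>, and \<open>\<alpha>2 \<ge> 1\<close> becomes
    \<open>i < N\<close>.\<close>
  have "(\<Sum>(\<alpha>1, \<alpha>2)\<in>{(\<alpha>1::nat, \<alpha>2::nat). \<alpha>1 + \<alpha>2 = p + 3 \<and> \<alpha>1 \<ge> 1 \<and> \<alpha>2 \<ge> 1}.
            ((l ^ (\<alpha>1 - 1) + 1) * (l + 1) ^ \<alpha>2 - l ^ (\<alpha>1 - 1) - l ^ \<alpha>2) * double_zeta \<alpha>1 (\<alpha>2 + 1))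
      = (\<Sum>i<N. ((l ^ i + 1) * (l + 1) ^ (N - i) - l ^ i - l ^ (N - i)) * ?d i)"
    by (rule sum.reindex_bij_witness[of _ "\<lambda>i. (i + 1, N - i)" "\<lambda>(a, b). a - 1"])
      (auto simp: N_def dest!: diff)
  also have "\<dots> = (\<Sum>i<N. ((l ^ i + 1) * (l + 1) ^ (N - i)) * ?d i)
      - (\<Sum>i<N. l ^ i * ?d i) - (\<Sum>i<N. l ^ (N - i) * ?d i)"
    by (simp add: left_diff_distrib sum_subtractf)
  also have "(\<Sum>i<N. l ^ i * ?d i) = double_zeta 1 (N + 1) + (\<Sum>i=1..<N. l ^ i * ?d i)"
    by (simp add: split_0)
  also have "(\<Sum>i<N. l ^ (N - i) * ?d i) = l ^ N * double_zeta 1 (N + 1)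
      + (\<Sum>j=1..<N. l ^ j * double_zeta (N - j + 1) (j + 1))"
    unfolding rev[symmetric] by (simp add: split_0)
  \<comment> \<open>The subtracted sums match the double zeta values in
    \<open>double_zeta_weighted_sum\<close> term by term, so only multiples of
    \<open>zeta (N + 2)\<close> survive, and their coefficients form the geometric sum.\<close>
  also have "(\<Sum>i<N. ((l ^ i + 1) * (l + 1) ^ (N - i)) * ?d i)
      - (double_zeta 1 (N + 1) + (\<Sum>i=1..<N. l ^ i * ?d i))
      - (l ^ N * double_zeta 1 (N + 1) + (\<Sum>j=1..<N. l ^ j * double_zeta (N - j + 1) (j + 1)))
      = ((\<Sum>j=1..<N. l ^ j) + 1 + l ^ N) * zeta (N + 2)"
    unfolding double_zeta_weighted_sum[OF N]
    by (simp add: distrib_left distrib_right sum.distrib sum_distrib_right)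
  finally show ?thesis
    unfolding geo weight .
qed

end
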